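(* Let $0<q<1$ and let $a,b,c,d$ be (generic, nonzero) complex parameters. Let $\mathcal R\{q^\gamma,E\}$, the involution $I$, the algebra $\mathcal B$ and the commutative algebra $\mathcal K$ be as in the context. The following conditions on an operator $T\in\mathcal R\{q^\gamma,E\}$ are equivalent: (i) $T$ is $I$-invariant, i.e. $I(T)=T$; (ii) $T$ has the form $\Theta^{-1}V$ for some operator $V\in\mathcal B$ and some (nonzero) function $\Theta\in\mathcal K$; (iii) $T$ has the form $U\Gamma^{-1}$ for some operator $U\in\mathcal B$ and some (nonzero) function $\Gamma\in\mathcal K$.
   Context: $E^{\pm1}h_\gamma=h_{\gamma\pm1}$. $\mathcal R\{q^\gamma,E\}$ is the algebra of difference operators $T=\sum_{j=m_1}^{m_2}h_j(q^\gamma)E^j$ with coefficients $h_j$ rational functions of $q^\gamma$ (so $E\,q^\gamma=q\,q^\gamma E$). $I$ is the automorphism of $\mathcal R\{q^\gamma,E\}$ with $I\circ I=\mathrm{Id}$ defined by $$I(q^\gamma)=\frac{q^{-\gamma+1}}{abcd},\qquad I(E)=E^{-1}.$$ $\mathcal B=\langle L_{a,b,c,d},\Lambda_\gamma\rangle$ is the algebra of difference operators generated by $L_{a,b,c,d}$ and $\Lambda_\gamma$, and $\mathcal K=\langle\Lambda_\gamma\rangle$ is the algebra of polynomials in $\Lambda_\gamma$, where $\Lambda_\gamma=q^{-\gamma}(1-q^\gamma)(1-abcdq^{\gamma-1})$ (acting by multiplication) and $L_{a,b,c,d}=A_\gamma E+B_\gamma\mathrm{Id}+C_\gamma E^{-1}$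 with $$A_\gamma=\frac{(1-abq^\gamma)(1-acq^\gamma)(1-adq^\gamma)(1-abcdq^{\gamma-1})}{a(1-abcdq^{2\gamma-1})(1-abcdq^{2\gamma})},\quad C_\gamma=\frac{a(1-q^\gamma)(1-bcq^{\gamma-1})(1-bdq^{\gamma-1})(1-cdq^{\gamma-1})}{(1-abcdq^{2\gamma-2})(1-abcdq^{2\gamma-1})},$$ $$B_\gamma=a+a^{-1}-(A_\gamma+C_\gamma).$$ *)

theory Defs
  imports
    "HOL-Computational_Algebra.Polynomial_Factorial"
    "HOL-Computational_Algebra.Field_as_Ring"
    "HOL-Computational_Algebra.Fundamental_Theorem_Algebra"
    "HOL-Algebra.Generated_Rings"
begin

section \<open>Rational functions of \<open>x = q\<^sup>\<gamma>\<close>\<close>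

text \<open>
  Since \<open>0 < q < 1\<close>, the function \<open>q\<^sup>\<gamma>\<close> of \<open>\<gamma>\<close> is transcendental over the constants, so a rational
  function of \<open>q\<^sup>\<gamma>\<close> is an element of the field of fractions of \<open>\<complex>[x]\<close>, with \<open>x\<close> standing for
  \<open>q\<^sup>\<gamma>\<close>.
\<close>

type_synonym ratfun = "complex poly fract"

definition rf_const :: "complex \<Rightarrow> ratfun" where
  "rf_const c = to_fract [:c:]"

definition rf_X :: ratfun where
  "rf_X = to_fract [:0, 1:]"

text \<open>\<open>rf_subst r f\<close> is \<open>f(r(x))\<close>. It is only meaningful if \<open>r\<close> is not constant: otherwise the
  denominator may evaluate to \<open>0\<close>.\<close>

definition rf_eval :: "ratfun \<Rightarrow> complex poly \<Rightarrow> ratfun" where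
  "rf_eval r p = poly (map_poly rf_const p) r"

definition rf_subst :: "ratfun \<Rightarrow> ratfun \<Rightarrow> ratfun" where
  "rf_subst r f = rf_eval r (fst (quot_of_fract f)) / rf_eval r (snd (quot_of_fract f))"


section \<open>Difference operators\<close>

text \<open>
  The operator \<open>\<Sum>\<^sub>j h\<^sub>j(q\<^sup>\<gamma>) E\<^sup>j\<close> is represented by its family of coefficients \<open>\<lambda>j. h\<^sub>j\<close>, which has
  finite support. As \<open>E\<^sup>i h\<^sub>\<gamma> = h\<^bsub>\<gamma>+i\<^esub> E\<^sup>i\<close>, moving \<open>E\<^sup>i\<close> past a coefficient replaces \<open>x\<close> by \<open>q\<^sup>i x\<close>.
\<close>

type_synonym diffop = "int \<Rightarrow> ratfun"

definition op_term :: "ratfun \<Rightarrow> int \<Rightarrow> diffop" where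
  "op_term h j = (\<lambda>i. if i = j then h else 0)"

definition rf_shift :: "complex \<Rightarrow> int \<Rightarrow> ratfun \<Rightarrow> ratfun" where
  "rf_shift q i h = rf_subst (rf_const (q powi i) * rf_X) h"

definition op_mult :: "complex \<Rightarrow> diffop \<Rightarrow> diffop \<Rightarrow> diffop" where
  "op_mult q S T = (\<lambda>n. \<Sum>i | S i \<noteq> 0. S i * rf_shift q i (T (n - i)))"

definition op_ring :: "complex \<Rightarrow> diffop ring" where
  "op_ring q =
     \<lparr>carrier = {T. finite {j. T j \<noteq> 0}},
      monoid.mult = op_mult q,
      one = op_term 1 0,
      zero = (\<lambda>_. 0),
      add = (\<lambda>S T j. S j + T j)\<rparr>"

abbreviation op_fun :: "ratfun \<Rightarrow> diffop" where
  "op_fun h \<equiv> op_term h 0"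

abbreviation op_E :: diffop where
  "op_E \<equiv> op_term 1 1"

abbreviation op_E_inv :: diffop where
  "op_E_inv \<equiv> op_term 1 (-1)"

text \<open>The unital \<open>\<complex>\<close>-algebra generated by \<open>H\<close>: adjoining the constants to the generators of a
  subring makes it closed under multiplication by scalars.\<close>

definition generate_algebra :: "complex \<Rightarrow> diffop set \<Rightarrow> diffop set" where
  "generate_algebra q H = generate_ring (op_ring q) (range (\<lambda>c. op_fun (rf_const c)) \<union> H)"


section \<open>The involution \<open>I\<close>\<close>

definition reflect :: "complex \<Rightarrow> complex \<Rightarrow> complex \<Rightarrow> complex \<Rightarrow> complex \<Rightarrow> ratfun \<Rightarrow> ratfun" where
  "reflect q a b c d h = rf_subst (rf_const (q / (a * b * c * d)) / rf_X) h"

text \<open>\<open>I (\<Sum>\<^sub>j h\<^sub>j(x) E\<^sup>j) = \<Sum>\<^sub>j h\<^sub>j(q / (abcd x)) E\<^bsup>-j\<^esup>\<close>. The lemmas at the end of this theory show that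
  this is the \<open>\<complex>\<close>-algebra automorphism determined by its values on \<open>q\<^sup>\<gamma>\<close> and \<open>E\<close>.\<close>

definition op_I :: "complex \<Rightarrow> complex \<Rightarrow> complex \<Rightarrow> complex \<Rightarrow> complex \<Rightarrow> diffop \<Rightarrow> diffop" where
  "op_I q a b c d T = (\<lambda>j. reflect q a b c d (T (- j)))"


section \<open>The operators \<open>\<Lambda>\<^sub>\<gamma>\<close> and \<open>L\<close>\<close>

definition Lam :: "complex \<Rightarrow> complex \<Rightarrow> complex \<Rightarrow> complex \<Rightarrow> complex \<Rightarrow> ratfun" where
  "Lam q a b c d = inverse rf_X * (1 - rf_X) * (1 - rf_const (a * b * c * d / q) * rf_X)"

definition A_coeff :: "complex \<Rightarrow> complex \<Rightarrow> complex \<Rightarrow> complex \<Rightarrow> complex \<Rightarrow> ratfun" where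
  "A_coeff q a b c d =
     (1 - rf_const (a * b) * rf_X) * (1 - rf_const (a * c) * rf_X) * (1 - rf_const (a * d) * rf_X)
       * (1 - rf_const (a * b * c * d / q) * rf_X)
     / (rf_const a * (1 - rf_const (a * b * c * d / q) * rf_X ^ 2)
         * (1 - rf_const (a * b * c * d) * rf_X ^ 2))"

definition C_coeff :: "complex \<Rightarrow> complex \<Rightarrow> complex \<Rightarrow> complex \<Rightarrow> complex \<Rightarrow> ratfun" where
  "C_coeff q a b c d =
     rf_const a * (1 - rf_X) * (1 - rf_const (b * c / q) * rf_X) * (1 - rf_const (b * d / q) * rf_X)
       * (1 - rf_const (c * d / q) * rf_X)
     / ((1 - rf_const (a * b * c * d / q ^ 2) * rf_X ^ 2)
         * (1 - rf_const (a * b * c * d / q) * rf_X ^ 2))"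

definition B_coeff :: "complex \<Rightarrow> complex \<Rightarrow> complex \<Rightarrow> complex \<Rightarrow> complex \<Rightarrow> ratfun" where
  "B_coeff q a b c d = rf_const (a + inverse a) - (A_coeff q a b c d + C_coeff q a b c d)"

definition op_L :: "complex \<Rightarrow> complex \<Rightarrow> complex \<Rightarrow> complex \<Rightarrow> complex \<Rightarrow> diffop" where
  "op_L q a b c d =
     (\<lambda>j. if j = 1 then A_coeff q a b c d
          else if j = 0 then B_coeff q a b c d
          else if j = -1 then C_coeff q a b c d else 0)"

definition op_Lam :: "complex \<Rightarrow> complex \<Rightarrow> complex \<Rightarrow> complex \<Rightarrow> complex \<Rightarrow> diffop" where
  "op_Lam q a b c d = op_fun (Lam q a b c d)"

definition alg_B :: "complex \<Rightarrow> complex \<Rightarrow> complex \<Rightarrow> complex \<Rightarrow> complex \<Rightarrow> diffop set" where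
  "alg_B q a b c d = generate_algebra q {op_L q a b c d, op_Lam q a b c d}"

definition alg_K :: "complex \<Rightarrow> complex \<Rightarrow> complex \<Rightarrow> complex \<Rightarrow> complex \<Rightarrow> diffop set" where
  "alg_K q a b c d = generate_algebra q {op_Lam q a b c d}"


section \<open>Substitution is a field homomorphism\<close>

lemma rf_const_0 [simp]: "rf_const 0 = 0"
  and rf_const_1 [simp]: "rf_const 1 = 1"
  by (simp_all add: rf_const_def flip: one_pCons)

lemma rf_const_add: "rf_const (u + v) = rf_const u + rf_const v"
  and rf_const_diff: "rf_const (u - v) = rf_const u - rf_const v"
  and rf_const_mult: "rf_const (u * v) = rf_const u * rf_const v"
  by (simp_all add: rf_const_def flip: to_fract_add to_fract_diff to_fract_mult)

lemma rf_const_eq_iff [simp]: "rf_const u = rf_const v \<longleftrightarrow> u = v"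
  by (simp add: rf_const_def)

lemma rf_const_eq_0_iff [simp]: "rf_const u = 0 \<longleftrightarrow> u = 0"
  by (simp add: rf_const_def)

lemma rf_const_inverse: "rf_const (inverse u) = inverse (rf_const u)"
proof (cases "u = 0")
  case False
  then have "rf_const (inverse u) * rf_const u = 1"
    by (simp flip: rf_const_mult)
  then show ?thesis
    by (metis inverse_unique mult.commute)
qed simp

lemma rf_const_divide: "rf_const (u / v) = rf_const u / rf_const v"
  by (simp add: divide_inverse rf_const_mult rf_const_inverse)

lemma rf_X_nonconst: "rf_X \<notin> range rf_const"
  by (auto simp: rf_X_def rf_const_def)

lemma rf_X_nz [simp]: "rf_X \<noteq> 0"
  by (simp add: rf_X_def)

lemma rf_eval_0 [simp]: "rf_eval r 0 = 0"
  by (simp add: rf_eval_def)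

lemma rf_eval_pCons [simp]: "rf_eval r (pCons u p) = rf_const u + r * rf_eval r p"
  by (simp add: rf_eval_def map_poly_pCons)

lemma rf_eval_1 [simp]: "rf_eval r 1 = 1"
  by (simp add: one_pCons)

lemma rf_eval_add: "rf_eval r (p + p') = rf_eval r p + rf_eval r p'"
  by (induction p p' rule: poly_induct2) (simp_all add: rf_const_add algebra_simps)

lemma rf_eval_smult: "rf_eval r (Polynomial.smult u p) = rf_const u * rf_eval r p"
  by (induction p) (simp_all add: rf_const_mult algebra_simps)

lemma rf_eval_mult: "rf_eval r (p * p') = rf_eval r p * rf_eval r p'"
  by (induction p) (simp_all add: rf_eval_add rf_eval_smult algebra_simps)

lemma rf_eval_nz:
  assumes "r \<notin> range rf_const" "p \<noteq> 0"
  shows "rf_eval r p \<noteq> 0"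
  using assms(2)
proof (induction "degree p" arbitrary: p)
  case 0
  then obtain u where "p = [:u:]" "u \<noteq> 0"
    by (metis degree_eq_zeroE pCons_0_0)
  then show ?case by simp
next
  case (Suc n)
  then have "\<not> constant (poly p)"
    by (simp add: constant_degree)
  then obtain z where "poly p z = 0"
    using fundamental_theorem_of_algebra by blast
  then obtain p' where p': "p = [:- z, 1:] * p'"
    using poly_eq_0_iff_dvd by (metis dvdE)
  with Suc have nz: "p' \<noteq> 0" by auto
  have "degree p = degree [:- z, 1:] + degree p'"
    unfolding p' using nz by (intro degree_mult_eq) auto
  with Suc have "n = degree p'" by simp
  with Suc(1) nz have "rf_eval r p' \<noteq> 0" by blast
  moreover have "rf_const (- z) + r \<noteq> 0"
    using assms(1) rf_const_diff[of 0 z] by (auto simp: algebra_simps)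
  ultimately show ?case
    unfolding p' rf_eval_mult by simp
qed

lemma rf_subst_frac:
  assumes "r \<notin> range rf_const" "w \<noteq> 0"
  shows "rf_subst r (to_fract v / to_fract w) = rf_eval r v / rf_eval r w"
proof -
  let ?f = "to_fract v / to_fract w"
  define v' w' where "v' = fst (quot_of_fract ?f)" and "w' = snd (quot_of_fract ?f)"
  have w': "w' \<noteq> 0" by (simp add: w'_def)
  have "to_fract v' / to_fract w' = ?f"
    unfolding v'_def w'_def
    by (metis Fract_conv_to_fract prod.collapse case_prod_conv quot_to_fract_def
        quot_to_fract_quot_of_fract)
  then have "to_fract (v' * w) = to_fract (v * w')"
    using assms w' by (simp add: divide_simps)
  then have "v' * w = v * w'" by (simp only: to_fract_eq_iff)
  then have "rf_eval r v' * rf_eval r w = rf_eval r v * rf_eval r w'"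
    by (metis rf_eval_mult)
  then show ?thesis
    using rf_eval_nz[OF assms(1) w'] rf_eval_nz[OF assms]
    unfolding rf_subst_def v'_def[symmetric] w'_def[symmetric] by (simp add: divide_simps)
qed

lemma ratfun_cases:
  obtains v w where "f = to_fract v / to_fract w" "w \<noteq> (0 :: complex poly)"
  by (metis Fract_conv_to_fract Fract_cases)

context
  fixes r assumes r: "r \<notin> range rf_const"
begin

lemma rf_subst_const: "rf_subst r (rf_const u) = rf_const u"
  using rf_subst_frac[OF r, of 1 "[:u:]"] by (simp add: rf_const_def)

lemma rf_subst_X: "rf_subst r rf_X = r"
  using rf_subst_frac[OF r, of 1 "[:0, 1:]"] by (simp add: rf_X_def)

lemma rf_subst_0: "rf_subst r 0 = 0"
  and rf_subst_1: "rf_subst r 1 = 1"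
  using rf_subst_const[of 0] rf_subst_const[of 1] by simp_all

lemma rf_subst_add: "rf_subst r (f + g) = rf_subst r f + rf_subst r g"
proof -
  obtain v w where f: "f = to_fract v / to_fract w" and w: "w \<noteq> 0" by (rule ratfun_cases)
  obtain v' w' where g: "g = to_fract v' / to_fract w'" and w': "w' \<noteq> 0" by (rule ratfun_cases)
  have "f + g = to_fract (v * w' + v' * w) / to_fract (w * w')"
    using w w' by (simp add: f g field_simps)
  then have "rf_subst r (f + g) = rf_eval r (v * w' + v' * w) / rf_eval r (w * w')"
    using rf_subst_frac[OF r, of "w * w'" "v * w' + v' * w"] w w' by simp
  then show ?thesis
    unfolding f g rf_subst_frac[OF r w] rf_subst_frac[OF r w']
    using rf_eval_nz[OF r w] rf_eval_nz[OF r w'] by (simp add: rf_eval_mult rf_eval_add field_simps)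
qed

lemma rf_subst_mult: "rf_subst r (f * g) = rf_subst r f * rf_subst r g"
proof -
  obtain v w where f: "f = to_fract v / to_fract w" and w: "w \<noteq> 0" by (rule ratfun_cases)
  obtain v' w' where g: "g = to_fract v' / to_fract w'" and w': "w' \<noteq> 0" by (rule ratfun_cases)
  have "f * g = to_fract (v * v') / to_fract (w * w')"
    by (simp add: f g)
  then have "rf_subst r (f * g) = rf_eval r (v * v') / rf_eval r (w * w')"
    using rf_subst_frac[OF r, of "w * w'" "v * v'"] w w' by simp
  then show ?thesis
    unfolding f g rf_subst_frac[OF r w] rf_subst_frac[OF r w'] by (simp add: rf_eval_mult)
qed

lemma rf_subst_minus: "rf_subst r (- f) = - rf_subst r f"
  using rf_subst_add[of f "- f"] by (simp add: rf_subst_0 eq_neg_iff_add_eq_0 add.commute)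

lemma rf_subst_diff: "rf_subst r (f - g) = rf_subst r f - rf_subst r g"
  using rf_subst_add[of f "- g"] by (simp add: rf_subst_minus)

lemma rf_subst_inverse: "rf_subst r (inverse f) = inverse (rf_subst r f)"
proof (cases "f = 0")
  case False
  then have "rf_subst r f * rf_subst r (inverse f) = 1"
    by (simp add: rf_subst_1 flip: rf_subst_mult)
  then show ?thesis by (metis inverse_unique)
qed (simp add: rf_subst_0)

lemma rf_subst_divide: "rf_subst r (f / g) = rf_subst r f / rf_subst r g"
  by (simp add: divide_inverse rf_subst_mult rf_subst_inverse)

lemma rf_subst_power: "rf_subst r (f ^ n) = rf_subst r f ^ n"
  by (induction n) (simp_all add: rf_subst_1 rf_subst_mult)

lemma rf_subst_sum: "rf_subst r (\<Sum>i\<in>S. f i) = (\<Sum>i\<in>S. rf_subst r (f i))"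
  by (induction S rule: infinite_finite_induct) (simp_all add: rf_subst_0 rf_subst_add)

lemma rf_subst_eval: "rf_subst r (rf_eval s p) = rf_eval (rf_subst r s) p"
  by (induction p) (simp_all add: rf_subst_0 rf_subst_add rf_subst_mult rf_subst_const)

lemma rf_subst_subst: "rf_subst r (rf_subst s f) = rf_subst (rf_subst r s) f"
  by (simp add: rf_subst_def[of s] rf_subst_def[of "rf_subst r s"] rf_subst_divide rf_subst_eval)

lemma rf_subst_eq_0_iff: "rf_subst r f = 0 \<longleftrightarrow> f = 0"
proof
  assume "rf_subst r f = 0"
  then have "rf_subst r (f * inverse f) = 0" by (simp add: rf_subst_mult)
  then show "f = 0" by (cases "f = 0") (simp_all add: rf_subst_1)
qed (simp add: rf_subst_0)

end

lemma rf_subst_id: "rf_subst rf_X f = f"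
proof -
  have "rf_eval rf_X p = to_fract p" for p
    by (induction p) (simp_all add: rf_const_def rf_X_def flip: to_fract_add to_fract_mult)
  then show ?thesis
    by (metis Fract_conv_to_fract prod.collapse case_prod_conv quot_to_fract_def
        quot_to_fract_quot_of_fract rf_subst_def)
qed

lemma scale_nonconst:
  assumes "u \<noteq> 0" shows "rf_const u * rf_X \<notin> range rf_const"
proof
  assume "rf_const u * rf_X \<in> range rf_const"
  then obtain v where "rf_const u * rf_X = rf_const v" by auto
  then have "rf_X = rf_const (v / u)" using assms by (simp add: rf_const_divide field_simps)
  then show False using rf_X_nonconst by blast
qed

lemma flip_nonconst:
  assumes "u \<noteq> 0" shows "rf_const u / rf_X \<notin> range rf_const"
proof
  assume "rf_const u / rf_X \<in> range rf_const"
  then obtain v where v: "rf_const u / rf_X = rf_const v" by auto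
  with assms have "v \<noteq> 0" by auto
  with v have "rf_X = rf_const (u / v)" by (simp add: rf_const_divide field_simps)
  then show False using rf_X_nonconst by blast
qed


section \<open>The difference operators form a ring\<close>

context
  fixes q :: complex
  assumes q: "q \<noteq> 0"
begin

lemma shift_nonconst: "rf_const (q powi i) * rf_X \<notin> range rf_const"
  using q by (intro scale_nonconst) simp

lemmas rf_shift_simps =
  rf_subst_0[OF shift_nonconst, folded rf_shift_def]
  rf_subst_1[OF shift_nonconst, folded rf_shift_def]
  rf_subst_const[OF shift_nonconst, folded rf_shift_def]
  rf_subst_add[OF shift_nonconst, folded rf_shift_def]
  rf_subst_mult[OF shift_nonconst, folded rf_shift_def]
  rf_subst_X[OF shift_nonconst, folded rf_shift_def]
  rf_subst_sum[OF shift_nonconst, folded rf_shift_def]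

lemma rf_shift_zero: "rf_shift q 0 f = f"
  by (simp add: rf_shift_def rf_subst_id)

lemma rf_shift_shift: "rf_shift q i (rf_shift q j f) = rf_shift q (i + j) f"
proof -
  note s = shift_nonconst[of i]
  have "rf_subst (rf_const (q powi i) * rf_X) (rf_const (q powi j) * rf_X)
      = rf_const (q powi (i + j)) * rf_X"
    unfolding rf_subst_mult[OF s] rf_subst_const[OF s] rf_subst_X[OF s]
    using q by (simp add: power_int_add rf_const_mult)
  then show ?thesis by (simp add: rf_shift_def rf_subst_subst[OF s])
qed

lemma op_mult_eq:
  assumes "finite A" "{i. S i \<noteq> 0} \<subseteq> A"
  shows "op_mult q S T n = (\<Sum>i\<in>A. S i * rf_shift q i (T (n - i)))"
  unfolding op_mult_def by (rule sum.mono_neutral_left) (use assms in auto)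

lemma op_mult_support:
  "{n. op_mult q S T n \<noteq> 0} \<subseteq> (\<lambda>(i, j). i + j) ` ({i. S i \<noteq> 0} \<times> {j. T j \<noteq> 0})"
proof
  fix n assume "n \<in> {n. op_mult q S T n \<noteq> 0}"
  then obtain i where i: "S i \<noteq> 0" "S i * rf_shift q i (T (n - i)) \<noteq> 0"
    unfolding op_mult_def by (auto elim: sum.not_neutral_contains_not_neutral)
  then have "T (n - i) \<noteq> 0" by (auto simp: rf_shift_simps)
  with i show "n \<in> (\<lambda>(i, j). i + j) ` ({i. S i \<noteq> 0} \<times> {j. T j \<noteq> 0})"
    by (intro image_eqI[of _ _ "(i, n - i)"]) auto
qed

lemma op_mult_finite:
  assumes "finite {i. S i \<noteq> 0}" "finite {j. T j \<noteq> 0}"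
  shows "finite {n. op_mult q S T n \<noteq> 0}"
  by (rule finite_subset[OF op_mult_support finite_imageI[OF finite_cartesian_product[OF assms]]])

lemma op_mult_term_left: "op_mult q (op_term h j) T = (\<lambda>n. h * rf_shift q j (T (n - j)))"
proof
  show "op_mult q (op_term h j) T n = h * rf_shift q j (T (n - j))" for n
  proof -
    have "{i. op_term h j i \<noteq> 0} \<subseteq> {j}" by (auto simp: op_term_def)
    then have "op_mult q (op_term h j) T n = (\<Sum>i\<in>{j}. op_term h j i * rf_shift q i (T (n - i)))"
      by (intro op_mult_eq) simp_all
    then show ?thesis by (simp add: op_term_def)
  qed
qed

lemma op_mult_term_term: "op_mult q (op_term g i) (op_term h j) = op_term (g * rf_shift q i h) (i + j)"
proof
  show "op_mult q (op_term g i) (op_term h j) n = op_term (g * rf_shift q i h) (i + j) n" for n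
    unfolding op_mult_term_left by (cases "n = i + j") (simp_all add: op_term_def rf_shift_simps)
qed

lemma op_mult_assoc:
  assumes S: "finite {i. S i \<noteq> 0}" and T: "finite {j. T j \<noteq> 0}"
  shows "op_mult q (op_mult q S T) U = op_mult q S (op_mult q T U)"
proof
  fix n
  define A B where "A = {i. S i \<noteq> 0}" and "B = {j. T j \<noteq> 0}"
  define M where "M = (\<lambda>(i, j). i + j) ` (A \<times> B)"
  note fin = S[folded A_def] T[folded B_def]
  have finM: "finite M" unfolding M_def using fin by simp
  have "op_mult q (op_mult q S T) U n = (\<Sum>m\<in>M. op_mult q S T m * rf_shift q m (U (n - m)))"
    using op_mult_support[of S T] finM by (intro op_mult_eq) (auto simp: M_def A_def B_def)
  also have "\<dots> = (\<Sum>m\<in>M. \<Sum>i\<in>A. S i * rf_shift q i (T (m - i)) * rf_shift q m (U (n - m)))"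
    by (simp add: op_mult_def A_def sum_distrib_right)
  also have "\<dots> = (\<Sum>i\<in>A. \<Sum>m\<in>M. S i * rf_shift q i (T (m - i)) * rf_shift q m (U (n - m)))"
    by (rule sum.swap)
  also have "\<dots> = (\<Sum>i\<in>A. \<Sum>j\<in>B. S i * rf_shift q i (T j) * rf_shift q (i + j) (U (n - i - j)))"
  proof (rule sum.cong[OF refl])
    fix i assume i: "i \<in> A"
    have "(\<Sum>m\<in>M. S i * rf_shift q i (T (m - i)) * rf_shift q m (U (n - m)))
        = (\<Sum>m\<in>(\<lambda>j. i + j) ` B. S i * rf_shift q i (T (m - i)) * rf_shift q m (U (n - m)))"
    proof (rule sum.mono_neutral_right[OF finM])
      show "(\<lambda>j. i + j) ` B \<subseteq> M" using i by (auto simp: M_def)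
      have "T (m - i) = 0" if "m \<notin> (\<lambda>j. i + j) ` B" for m
        using that by (force simp: B_def image_iff)
      then show "\<forall>m\<in>M - (\<lambda>j. i + j) ` B.
          S i * rf_shift q i (T (m - i)) * rf_shift q m (U (n - m)) = 0"
        by (auto simp: rf_shift_simps)
    qed
    also have "\<dots> = (\<Sum>j\<in>B. S i * rf_shift q i (T j) * rf_shift q (i + j) (U (n - i - j)))"
      by (subst sum.reindex) (auto simp: algebra_simps)
    finally show "(\<Sum>m\<in>M. S i * rf_shift q i (T (m - i)) * rf_shift q m (U (n - m)))
        = (\<Sum>j\<in>B. S i * rf_shift q i (T j) * rf_shift q (i + j) (U (n - i - j)))" .
  qed
  also have "\<dots> = op_mult q S (op_mult q T U) n"
    by (simp add: op_mult_def[of q S] op_mult_def[of q T] A_def B_def rf_shift_simps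
        rf_shift_shift sum_distrib_left mult.assoc)
  finally show "op_mult q (op_mult q S T) U n = op_mult q S (op_mult q T U) n" .
qed

lemma op_mult_one_right:
  assumes "finite {i. S i \<noteq> 0}"
  shows "op_mult q S (op_term 1 0) = S"
proof
  fix n
  have "op_mult q S (op_term 1 0) n = (\<Sum>i | S i \<noteq> 0. if i = n then S n else 0)"
    unfolding op_mult_def by (rule sum.cong) (auto simp: op_term_def rf_shift_simps)
  also have "\<dots> = S n"
    using assms by simp
  finally show "op_mult q S (op_term 1 0) n = S n" .
qed

lemma op_mult_add_left:
  assumes "finite {i. S i \<noteq> 0}" "finite {i. T i \<noteq> 0}"
  shows "op_mult q (\<lambda>j. S j + T j) U = (\<lambda>j. op_mult q S U j + op_mult q T U j)"
proof
  fix n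
  define A where "A = {i. S i \<noteq> 0} \<union> {i. T i \<noteq> 0}"
  have A: "finite A" using assms by (simp add: A_def)
  have "op_mult q (\<lambda>j. S j + T j) U n = (\<Sum>i\<in>A. (S i + T i) * rf_shift q i (U (n - i)))"
    by (rule op_mult_eq[OF A]) (auto simp: A_def)
  moreover have "op_mult q S U n = (\<Sum>i\<in>A. S i * rf_shift q i (U (n - i)))"
    by (rule op_mult_eq[OF A]) (auto simp: A_def)
  moreover have "op_mult q T U n = (\<Sum>i\<in>A. T i * rf_shift q i (U (n - i)))"
    by (rule op_mult_eq[OF A]) (auto simp: A_def)
  ultimately show "op_mult q (\<lambda>j. S j + T j) U n = op_mult q S U n + op_mult q T U n"
    by (simp add: sum.distrib distrib_right)
qed

lemma op_mult_add_right:
  "op_mult q S (\<lambda>j. T j + U j) = (\<lambda>j. op_mult q S T j + op_mult q S U j)"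
  by (simp add: op_mult_def rf_shift_simps sum.distrib distrib_left)

lemma finite_support_add:
  "finite {i. S i \<noteq> 0} \<Longrightarrow> finite {i. T i \<noteq> 0} \<Longrightarrow> finite {i. S i + T i \<noteq> (0 :: ratfun)}"
  by (rule finite_subset[of _ "{i. S i \<noteq> 0} \<union> {i. T i \<noteq> 0}"]) auto

lemma finite_support_term: "finite {i. op_term h j i \<noteq> 0}"
  by (rule finite_subset[of _ "{j}"]) (auto simp: op_term_def)

lemma op_ring_ring: "ring (op_ring q)"
proof (rule ringI)
  show "abelian_group (op_ring q)"
  proof (rule abelian_groupI)
    fix S assume "S \<in> carrier (op_ring q)"
    then show "\<exists>T\<in>carrier (op_ring q). T \<oplus>\<^bsub>op_ring q\<^esub> S = \<zero>\<^bsub>op_ring q\<^esub>"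
      by (intro bexI[of _ "\<lambda>j. - S j"]) (simp_all add: op_ring_def)
  qed (simp_all add: op_ring_def finite_support_add finite_support_term add_ac)
  show "Group.monoid (op_ring q)"
    by (rule monoidI)
      (simp_all add: op_ring_def op_mult_finite op_mult_assoc op_mult_one_right
        op_mult_term_left rf_shift_zero finite_support_term)
next
  fix S T U
  assume "S \<in> carrier (op_ring q)" "T \<in> carrier (op_ring q)"
  then show "(S \<oplus>\<^bsub>op_ring q\<^esub> T) \<otimes>\<^bsub>op_ring q\<^esub> U
      = S \<otimes>\<^bsub>op_ring q\<^esub> U \<oplus>\<^bsub>op_ring q\<^esub> T \<otimes>\<^bsub>op_ring q\<^esub> U"
    by (simp add: op_ring_def op_mult_add_left[of S T])
next
  fix S T U
  show "U \<otimes>\<^bsub>op_ring q\<^esub> (S \<oplus>\<^bsub>op_ring q\<^esub> T)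
      = U \<otimes>\<^bsub>op_ring q\<^esub> S \<oplus>\<^bsub>op_ring q\<^esub> U \<otimes>\<^bsub>op_ring q\<^esub> T"
    by (simp add: op_ring_def op_mult_add_right[of U S T])
qed

lemma E_times_X:
  "op_E \<otimes>\<^bsub>op_ring q\<^esub> op_fun rf_X
     = op_fun (rf_const q) \<otimes>\<^bsub>op_ring q\<^esub> op_fun rf_X \<otimes>\<^bsub>op_ring q\<^esub> op_E"
  by (simp add: op_ring_def op_mult_term_term rf_shift_simps)

lemma E_times_E_inv: "op_E \<otimes>\<^bsub>op_ring q\<^esub> op_E_inv = \<one>\<^bsub>op_ring q\<^esub>"
  by (simp add: op_ring_def op_mult_term_term rf_shift_simps)

lemma inv_op_fun:
  assumes "h \<noteq> 0"
  shows "inv\<^bsub>op_ring q\<^esub> (op_fun h) = op_fun (inverse h)"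
proof -
  interpret ring "op_ring q" by (rule op_ring_ring)
  show ?thesis
    using assms by (intro inv_char)
      (simp_all add: op_ring_def op_mult_term_term rf_shift_zero finite_support_term)
qed

lemma op_fun_mult: "op_fun g \<otimes>\<^bsub>op_ring q\<^esub> op_fun h = op_fun (g * h)"
  by (simp add: op_ring_def op_mult_term_term rf_shift_zero)

lemma op_fun_add: "op_fun g \<oplus>\<^bsub>op_ring q\<^esub> op_fun h = op_fun (g + h)"
  by (auto simp: op_ring_def op_term_def)

lemma op_fun_minus: "\<ominus>\<^bsub>op_ring q\<^esub> op_fun h = op_fun (- h)"
proof -
  interpret ring "op_ring q" by (rule op_ring_ring)
  show ?thesis
    by (rule minus_equality) (auto simp: op_ring_def op_term_def finite_support_term)
qed

lemma alg_K_eq: "alg_K q a b c d = range (\<lambda>p. op_fun (rf_eval (Lam q a b c d) p))"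
proof (intro equalityI subsetI)
  fix \<Theta> assume "\<Theta> \<in> alg_K q a b c d"
  then show "\<Theta> \<in> range (\<lambda>p. op_fun (rf_eval (Lam q a b c d) p))"
    unfolding alg_K_def generate_algebra_def
  proof (induction rule: generate_ring.induct)
    case one
    show ?case by (rule range_eqI[of _ _ 1]) (simp add: op_ring_def)
  next
    case (incl h)
    then consider u where "h = op_fun (rf_const u)" | "h = op_fun (Lam q a b c d)"
      by (auto simp: op_Lam_def)
    then show ?case
    proof cases
      case (1 u)
      then show ?thesis by (intro range_eqI[of _ _ "[:u:]"]) simp
    next
      case 2
      then show ?thesis by (intro range_eqI[of _ _ "[:0, 1:]"]) simp
    qed
  next
    case (a_inv h)
    then obtain p where "h = op_fun (rf_eval (Lam q a b c d) p)" by auto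
    then show ?case
      using rf_eval_smult[of _ "- 1" p] rf_const_diff[of 0 1]
      by (intro range_eqI[of _ _ "Polynomial.smult (- 1) p"]) (simp add: op_fun_minus)
  next
    case (eng_add h1 h2)
    then obtain p p' where "h1 = op_fun (rf_eval (Lam q a b c d) p)"
        "h2 = op_fun (rf_eval (Lam q a b c d) p')" by blast
    then show ?case
      by (intro range_eqI[of _ _ "p + p'"]) (simp add: op_fun_add rf_eval_add)
  next
    case (eng_mult h1 h2)
    then obtain p p' where "h1 = op_fun (rf_eval (Lam q a b c d) p)"
        "h2 = op_fun (rf_eval (Lam q a b c d) p')" by blast
    then show ?case
      by (intro range_eqI[of _ _ "p * p'"]) (simp add: op_fun_mult rf_eval_mult)
  qed
next
  fix \<Theta> assume "\<Theta> \<in> range (\<lambda>p. op_fun (rf_eval (Lam q a b c d) p))"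
  then obtain p where "\<Theta> = op_fun (rf_eval (Lam q a b c d) p)" by auto
  moreover have const: "op_fun (rf_const u) \<in> alg_K q a b c d" for u
    unfolding alg_K_def generate_algebra_def by (intro generate_ring.incl) blast
  have Lam: "op_fun (Lam q a b c d) \<in> alg_K q a b c d"
    unfolding alg_K_def generate_algebra_def op_Lam_def by (intro generate_ring.incl) blast
  have "op_fun (rf_eval (Lam q a b c d) p) \<in> alg_K q a b c d"
  proof (induction p)
    case 0
    show ?case using const[of 0] by simp
  next
    case (pCons u p)
    have "op_fun (rf_const u) \<oplus>\<^bsub>op_ring q\<^esub>
        (op_fun (Lam q a b c d) \<otimes>\<^bsub>op_ring q\<^esub> op_fun (rf_eval (Lam q a b c d) p)) \<in> alg_K q a b c d"
      using const[of u] Lam pCons.IH unfolding alg_K_def generate_algebra_def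
      by (intro generate_ring.eng_add generate_ring.eng_mult)
    then show ?case by (simp add: op_fun_mult op_fun_add)
  qed
  ultimately show "\<Theta> \<in> alg_K q a b c d" by simp
qed

lemma op_E_inv_eq: "op_E_inv = inv\<^bsub>op_ring q\<^esub> op_E"
proof -
  interpret ring "op_ring q" by (rule op_ring_ring)
  show ?thesis
    by (rule inv_char[symmetric])
      (simp_all add: op_ring_def op_mult_term_term rf_shift_simps finite_support_term)
qed

end


section \<open>\<open>I\<close> is the automorphism with \<open>I(q\<^sup>\<gamma>) = q / (abcd q\<^sup>\<gamma>)\<close> and \<open>I(E) = E\<^sup>-\<^sup>1\<close>\<close>

context
  fixes q a b c d :: complex
  assumes q: "q \<noteq> 0" and abcd: "a \<noteq> 0" "b \<noteq> 0" "c \<noteq> 0" "d \<noteq> 0"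
begin

lemma reflect_nonconst: "rf_const (q / (a * b * c * d)) / rf_X \<notin> range rf_const"
  using q abcd by (intro flip_nonconst) simp

lemmas reflect_simps =
  rf_subst_0[OF reflect_nonconst, folded reflect_def]
  rf_subst_1[OF reflect_nonconst, folded reflect_def]
  rf_subst_const[OF reflect_nonconst, folded reflect_def]
  rf_subst_add[OF reflect_nonconst, folded reflect_def]
  rf_subst_mult[OF reflect_nonconst, folded reflect_def]
  rf_subst_X[OF reflect_nonconst, folded reflect_def]
  rf_subst_sum[OF reflect_nonconst, folded reflect_def]
  rf_subst_diff[OF reflect_nonconst, folded reflect_def]
  rf_subst_divide[OF reflect_nonconst, folded reflect_def]
  rf_subst_inverse[OF reflect_nonconst, folded reflect_def]
  rf_subst_power[OF reflect_nonconst, folded reflect_def]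

lemma reflect_eq_0_iff: "reflect q a b c d f = 0 \<longleftrightarrow> f = 0"
  using rf_subst_eq_0_iff[OF reflect_nonconst] by (simp add: reflect_def)

lemma reflect_reflect: "reflect q a b c d (reflect q a b c d f) = f"
proof -
  define k where "k = q / (a * b * c * d)"
  have k: "k \<noteq> 0" using q abcd by (simp add: k_def)
  note r = flip_nonconst[OF k]
  show ?thesis
    unfolding reflect_def k_def[symmetric] rf_subst_subst[OF r]
    using k by (simp add: rf_subst_divide[OF r] rf_subst_const[OF r] rf_subst_X[OF r] rf_subst_id)
qed

lemma reflect_shift: "reflect q a b c d (rf_shift q i f) = rf_shift q (- i) (reflect q a b c d f)"
proof -
  define k where "k = q / (a * b * c * d)"
  have k: "k \<noteq> 0" using q abcd by (simp add: k_def)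
  note r = flip_nonconst[OF k] and s = shift_nonconst[OF q, of "- i"]
  have "rf_subst (rf_const k / rf_X) (rf_const (q powi i) * rf_X)
      = rf_const k * rf_const (q powi i) / rf_X"
    by (simp add: rf_subst_mult[OF r] rf_subst_const[OF r] rf_subst_X[OF r] mult.commute)
  moreover have "rf_subst (rf_const (q powi - i) * rf_X) (rf_const k / rf_X)
      = rf_const k * rf_const (q powi i) / rf_X"
    unfolding rf_subst_divide[OF s] rf_subst_const[OF s] rf_subst_X[OF s]
    using q by (simp add: power_int_minus rf_const_inverse divide_inverse mult_ac)
  ultimately show ?thesis
    by (simp add: reflect_def rf_shift_def k_def[symmetric] rf_subst_subst[OF r] rf_subst_subst[OF s])
qed

lemma finite_support_uminus:
  "finite {j. T (- j) \<noteq> (0 :: ratfun)} \<longleftrightarrow> finite {j :: int. T j \<noteq> 0}"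
proof -
  have "{j. T (- j) \<noteq> 0} = uminus ` {j. T j \<noteq> 0}"
    by (force simp: image_iff intro: exI[of _ "- _"])
  then show ?thesis by (simp add: finite_image_iff)
qed

lemma op_I_I: "op_I q a b c d (op_I q a b c d T) = T"
  by (simp add: op_I_def reflect_reflect)

lemma op_I_mult:
  "op_I q a b c d (op_mult q S T) = op_mult q (op_I q a b c d S) (op_I q a b c d T)"
proof
  fix n
  have "op_I q a b c d (op_mult q S T) n
      = (\<Sum>i | S i \<noteq> 0. reflect q a b c d (S i) * rf_shift q (- i) (reflect q a b c d (T (- n - i))))"
    by (simp add: op_I_def op_mult_def reflect_simps reflect_shift)
  also have "\<dots> = (\<Sum>i | S (- i) \<noteq> 0.
      reflect q a b c d (S (- i)) * rf_shift q i (reflect q a b c d (T (- n + i))))"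
    by (rule sum.reindex_bij_witness[of _ uminus uminus]) auto
  also have "\<dots> = op_mult q (op_I q a b c d S) (op_I q a b c d T) n"
    by (simp add: op_I_def op_mult_def reflect_eq_0_iff algebra_simps)
  finally show "op_I q a b c d (op_mult q S T) n
      = op_mult q (op_I q a b c d S) (op_I q a b c d T) n" .
qed

lemma op_I_fun: "op_I q a b c d (op_fun h) = op_fun (reflect q a b c d h)"
  by (auto simp: op_I_def op_term_def reflect_simps)

lemma op_I_const: "op_I q a b c d (op_fun (rf_const u)) = op_fun (rf_const u)"
  by (simp add: op_I_fun reflect_simps)

lemma op_I_X:
  "op_I q a b c d (op_fun rf_X) = op_fun (rf_const (q / (a * b * c * d)) * inverse rf_X)"
  by (simp add: op_I_fun reflect_simps divide_inverse)

lemma op_I_E: "op_I q a b c d op_E = op_E_inv"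
  by (auto simp: op_I_def op_term_def reflect_simps)

lemma op_I_closed: "T \<in> carrier (op_ring q) \<Longrightarrow> op_I q a b c d T \<in> carrier (op_ring q)"
  by (simp add: op_ring_def op_I_def reflect_eq_0_iff finite_support_uminus)

lemma op_I_ring_iso: "op_I q a b c d \<in> ring_iso (op_ring q) (op_ring q)"
proof (rule ring_iso_memI)
  show "bij_betw (op_I q a b c d) (carrier (op_ring q)) (carrier (op_ring q))"
    by (rule bij_betw_byWitness[of _ "op_I q a b c d"]) (auto simp: op_I_I op_I_closed)
next
  show "op_I q a b c d \<one>\<^bsub>op_ring q\<^esub> = \<one>\<^bsub>op_ring q\<^esub>"
    by (simp add: op_ring_def op_I_fun reflect_simps)
next
  fix S T
  show "op_I q a b c d (S \<otimes>\<^bsub>op_ring q\<^esub> T) = op_I q a b c d S \<otimes>\<^bsub>op_ring q\<^esub> op_I q a b c d T"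
    by (simp add: op_ring_def op_I_mult)
  show "op_I q a b c d (S \<oplus>\<^bsub>op_ring q\<^esub> T) = op_I q a b c d S \<oplus>\<^bsub>op_ring q\<^esub> op_I q a b c d T"
    by (simp add: op_ring_def op_I_def reflect_simps)
qed (rule op_I_closed)

end

end

theory Submission
  imports Defs
begin

text \<open>
  All elements of \<open>\<B>\<close> are invariant, because the reflection \<open>\<rho>\<close> of \<open>\<complex>(x)\<close> fixes \<open>\<Lambda>\<close> and exchanges
  \<open>A\<^sub>\<gamma>\<close> with \<open>C\<^sub>\<gamma>\<close>. Conversely, let \<open>T\<close> be invariant with top coefficient \<open>h\<close> at \<open>E\<^sup>n\<close>, \<open>n > 0\<close>. The
  fixed field of \<open>\<rho>\<close> is \<open>\<complex>(\<Lambda>)\<close>, and \<open>\<complex>(x)\<close> has degree 2 over it, with basis \<open>1\<close> and \<open>E\<^sup>n(\<Lambda>)\<close> as the latter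
  is not fixed by \<open>\<rho>\<close>. So there are \<open>f\<close> and \<open>g\<close> in \<open>\<complex>(\<Lambda>)\<close> for which \<open>f L\<^sup>n + g L\<^sup>n \<Lambda>\<close> has top coefficient
  \<open>h\<close>. Subtracting this lowers \<open>n\<close>, and also removes the coefficient at \<open>E\<^bsup>-n\<^esup>\<close> by invariance. For
  \<open>n = 0\<close> the operator is an element of \<open>\<complex>(\<Lambda>)\<close>. Fractions with denominators on the right are
  obtained in the same way from \<open>L\<^sup>n f + \<Lambda> L\<^sup>n g\<close>.
\<close>

context
  fixes q a b c d :: complex
  assumes q: "q \<noteq> 0" and abcd: "a \<noteq> 0" "b \<noteq> 0" "c \<noteq> 0" "d \<noteq> 0"
begin

abbreviation (input) R where "R \<equiv> op_ring q"
abbreviation (input) \<rho> where "\<rho> \<equiv> reflect q a b c d"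
abbreviation (input) II where "II \<equiv> op_I q a b c d"
abbreviation (input) \<Lambda> where "\<Lambda> \<equiv> Lam q a b c d"
abbreviation (input) \<B> where "\<B> \<equiv> alg_B q a b c d"

interpretation R: ring R
  using q by (rule op_ring_ring)

lemmas reflect_hom = reflect_simps[OF q abcd]
lemmas shift_hom = rf_shift_simps[OF q]
  rf_subst_diff[OF shift_nonconst[OF q], folded rf_shift_def]
  rf_subst_divide[OF shift_nonconst[OF q], folded rf_shift_def]
  rf_subst_inverse[OF shift_nonconst[OF q], folded rf_shift_def]

section \<open>The reflection on \<open>\<Lambda>\<close> and on the coefficients of
  \<open>L\<close>\<close>

lemma Lam_eq: "\<Lambda> = inverse rf_X + rf_const (a * b * c * d / q) * rf_X - rf_const (1 + a * b * c * d / q)"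
  by (simp add: Lam_def rf_const_add field_simps)

lemma reflect_X: "\<rho> rf_X = inverse (rf_const (a * b * c * d / q) * rf_X)"
  by (simp add: reflect_hom rf_const_divide field_simps)

text \<open>With \<open>k = a * b * c * d / q\<close>, the map x -> 1/(k x) swaps the summands 1/x
  and k x in \<open>Lam_eq\<close>.\<close>

lemma reflect_Lam: "\<rho> \<Lambda> = \<Lambda>"
proof -
  have "rf_const (a * b * c * d / q) \<noteq> 0"
    using q abcd by simp
  then show ?thesis
    unfolding Lam_eq reflect_hom(8,4,5,10,3) reflect_X by simp
qed

text \<open>Clearing the denominator in \<open>\<Lambda> = u\<close> gives u x = (1 - x)(1 - k x),
  which fails at x = 0. This is what makes substitution of \<open>\<Lambda>\<close> a field
  homomorphism.\<close>

lemma Lam_nonconst: "\<Lambda> \<notin> range rf_const"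
proof
  assume "\<Lambda> \<in> range rf_const"
  then obtain u where "\<Lambda> = rf_const u" by auto
  then have "rf_const u * rf_X = (1 - rf_X) * (1 - rf_const (a * b * c * d / q) * rf_X)"
    unfolding Lam_def by (simp add: field_simps)
  then have "to_fract ([:u:] * [:0, 1:])
      = to_fract ((1 - [:0, 1:]) * (1 - [:a * b * c * d / q:] * [:0, 1:]))"
    unfolding rf_const_def rf_X_def to_fract_mult to_fract_diff to_fract_1 .
  then have "[:u:] * [:0, 1:] = (1 - [:0, 1:]) * (1 - [:a * b * c * d / q:] * [:0, 1:])"
    by (simp only: to_fract_eq_iff)
  then have "poly ([:u:] * [:0, 1:]) 0
      = poly ((1 - [:0, 1:]) * (1 - [:a * b * c * d / q:] * [:0, 1:])) 0"
    by (rule arg_cong)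
  then show False by simp
qed

text \<open>The polynomial takes the value 1 at x = 0, whatever \<open>u\<close> is.\<close>

lemma one_minus_X_sq_nz: "1 - rf_const u * rf_X ^ 2 \<noteq> 0"
proof
  assume "1 - rf_const u * rf_X ^ 2 = 0"
  then have "to_fract (1 - [:u:] * [:0, 1:] ^ 2) = 0"
    unfolding rf_const_def rf_X_def power2_eq_square to_fract_mult to_fract_diff to_fract_1 .
  then have "poly (1 - [:u:] * [:0, 1:] ^ 2) 0 = 0"
    by (simp only: to_fract_eq_0_iff poly_0)
  then show False by simp
qed

lemma one_minus_X_nz: "1 - rf_const u * rf_X \<noteq> 0"
proof
  assume "1 - rf_const u * rf_X = 0"
  then have "to_fract (1 - [:u:] * [:0, 1:]) = 0"
    unfolding rf_const_def rf_X_def to_fract_mult to_fract_diff to_fract_1 .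
  then have "poly (1 - [:u:] * [:0, 1:]) 0 = 0"
    by (simp only: to_fract_eq_0_iff poly_0)
  then show False by simp
qed

lemma A_coeff_nz: "A_coeff q a b c d \<noteq> 0"
  using abcd unfolding A_coeff_def
  by (simp only: divide_eq_0_iff mult_eq_0_iff one_minus_X_nz one_minus_X_sq_nz rf_const_eq_0_iff
      de_Morgan_disj simp_thms)

text \<open>Since u v = abcd/q, the reflection carries the root 1/u to 1/v; the denominator is what
  remains after clearing 1/x.\<close>

lemma reflect_linear:
  assumes "u \<noteq> 0" "v = a * b * c * d / (u * q)"
  shows "\<rho> (1 - rf_const u * rf_X) = - (1 - rf_const v * rf_X) / (rf_const v * rf_X)"
proof -
  have "v \<noteq> 0" "rf_const (a * b * c * d / q) = rf_const (u * v)"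
    using assms q abcd by auto
  then show ?thesis
    using assms(1) unfolding reflect_hom(8,5,2,3) reflect_X
    by (simp add: rf_const_mult field_simps)
qed

lemma reflect_quadratic:
  assumes "u \<noteq> 0" "v = (a * b * c * d / q)\<^sup>2 / u"
  shows "\<rho> (1 - rf_const u * rf_X ^ 2) = - (1 - rf_const v * rf_X ^ 2) / (rf_const v * rf_X ^ 2)"
proof -
  have "v \<noteq> 0" "(a * b * c * d / q)\<^sup>2 = u * v"
    using assms q abcd by auto
  then have "v \<noteq> 0" "rf_const (a * b * c * d / q) ^ 2 = rf_const u * rf_const v"
    by (simp_all add: power2_eq_square flip: rf_const_mult)
  then show ?thesis
    using assms(1) unfolding reflect_hom(8,5,2,3,11) reflect_X
    by (simp add: power_inverse power_mult_distrib field_simps)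
qed

text \<open>The reflection pairs the linear factors ab with cd/q, ac with bd/q, ad with bc/q, and
  abcd/q with 1. Of the quadratic ones it keeps abcd/q and sends abcd to abcd/q^2. The six signs
  cancel.\<close>

lemma reflect_A: "\<rho> (A_coeff q a b c d) = C_coeff q a b c d"
proof -
  let ?f = "\<lambda>u. 1 - rf_const u * rf_X" and ?g = "\<lambda>u. 1 - rf_const u * rf_X ^ 2"
  let ?x = "rf_X"
  have r: "\<rho> (?f (a * b)) = - ?f (c * d / q) / (rf_const (c * d / q) * ?x)"
    "\<rho> (?f (a * c)) = - ?f (b * d / q) / (rf_const (b * d / q) * ?x)"
    "\<rho> (?f (a * d)) = - ?f (b * c / q) / (rf_const (b * c / q) * ?x)"
    "\<rho> (?f (a * b * c * d / q)) = - ?f 1 / (rf_const 1 * ?x)"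
    using q abcd by (intro reflect_linear; simp)+
  have s: "\<rho> (?g (a * b * c * d / q))
      = - ?g (a * b * c * d / q) / (rf_const (a * b * c * d / q) * ?x ^ 2)"
    "\<rho> (?g (a * b * c * d)) = - ?g (a * b * c * d / q ^ 2) / (rf_const (a * b * c * d / q ^ 2) * ?x ^ 2)"
    using q abcd by (intro reflect_quadratic; simp add: field_simps power2_eq_square)+
  have nz: "rf_const a \<noteq> 0" "rf_const b \<noteq> 0" "rf_const c \<noteq> 0" "rf_const d \<noteq> 0" "rf_const q \<noteq> 0"
    using q abcd by simp_all
  \<comment> \<open>The monomials left over from numerator and denominator: the powers of x agree,
    and the constants differ by exactly a^2, which turns the prefactor 1/a of \<open>A_coeff\<close>
    into the prefactor a of \<open>C_coeff\<close>.\<close>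
  have *: "rf_const (c * d / q) * ?x * (rf_const (b * d / q) * ?x) * (rf_const (b * c / q) * ?x) * (rf_const 1 * ?x)
      * rf_const a ^ 2
      = rf_const (a * b * c * d / q) * ?x ^ 2 * (rf_const (a * b * c * d / q ^ 2) * ?x ^ 2)"
    using nz by (simp add: rf_const_mult rf_const_divide power2_eq_square field_simps)
  have aux: "(- f1 / u1) * (- f2 / u2) * (- f3 / u3) * (- f4 / u4) / (\<alpha> * (- g1 / v1) * (- g2 / v2))
      = \<alpha> * f4 * f3 * f2 * f1 / (g2 * g1)"
    if "u1 * u2 * u3 * u4 * \<alpha> ^ 2 = v1 * v2" "u1 \<noteq> 0" "u2 \<noteq> 0" "u3 \<noteq> 0" "u4 \<noteq> 0"
      "\<alpha> \<noteq> 0" "v1 \<noteq> 0" "v2 \<noteq> 0" "g1 \<noteq> 0" "g2 \<noteq> 0"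
    for f1 f2 f3 f4 u1 u2 u3 u4 \<alpha> g1 g2 v1 v2 :: ratfun
  proof -
    have "(- f1 / u1) * (- f2 / u2) * (- f3 / u3) * (- f4 / u4) / (\<alpha> * (- g1 / v1) * (- g2 / v2))
      = f1 * f2 * f3 * f4 * (v1 * v2) / (u1 * u2 * u3 * u4 * \<alpha> * (g1 * g2))"
      using that(2-) by (simp add: field_simps)
    also have "\<dots> = \<alpha> * f4 * f3 * f2 * f1 / (g2 * g1)"
      using that(2-) unfolding that(1)[symmetric] by (simp add: field_simps power2_eq_square)
    finally show ?thesis .
  qed
  have "\<rho> (A_coeff q a b c d)
      = rf_const a * ?f 1 * ?f (b * c / q) * ?f (b * d / q) * ?f (c * d / q)
        / (?g (a * b * c * d / q ^ 2) * ?g (a * b * c * d / q))"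
    unfolding A_coeff_def reflect_hom(9,5) r s reflect_hom(3)
    by (rule aux[OF * _ _ _ _ _ _ _ one_minus_X_sq_nz one_minus_X_sq_nz]) (use q abcd in simp_all)
  then show ?thesis by (simp add: C_coeff_def)
qed

lemma reflect_C: "\<rho> (C_coeff q a b c d) = A_coeff q a b c d"
  by (metis reflect_A reflect_reflect[OF q abcd])

lemma reflect_B: "\<rho> (B_coeff q a b c d) = B_coeff q a b c d"
  by (simp only: B_coeff_def reflect_hom(8,4,3) reflect_A reflect_C add.commute)

lemma op_I_L: "II (op_L q a b c d) = op_L q a b c d"
proof
  show "II (op_L q a b c d) j = op_L q a b c d j" for j
    unfolding op_I_def op_L_def using reflect_A reflect_B reflect_C
    by (auto simp: reflect_hom(1))
qed

section \<open>The algebra \<open>\<B>\<close> and the invariance of its elements\<close>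

lemma op_L_closed: "op_L q a b c d \<in> carrier R"
proof -
  have "{j. op_L q a b c d j \<noteq> 0} \<subseteq> {-1, 0, 1}"
    by (auto simp: op_L_def)
  then show ?thesis
    using finite_subset by (auto simp: op_ring_def)
qed

lemma op_fun_closed: "op_fun h \<in> carrier R"
  by (simp add: op_ring_def finite_support_term[OF q])

text \<open>\<open>II\<close> is a ring homomorphism fixing the generators. Membership in the
  carrier is carried along because the homomorphism laws hold only there.\<close>

lemma alg_B_closed_invariant:
  assumes "V \<in> \<B>"
  shows "V \<in> carrier R \<and> II V = V"
  using assms unfolding alg_B_def generate_algebra_def
proof (induction rule: generate_ring.induct)
  have hom: "II \<in> ring_hom R R"
    using op_I_ring_iso[OF q abcd] by (simp add: ring_iso_def)
  {
    case one
    show ?case using ring_hom_one[OF hom] by simp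
  next
    case (incl h)
    then show ?case
      using op_L_closed op_I_L
      by (auto simp: op_fun_closed op_Lam_def op_I_fun[OF q abcd] reflect_Lam reflect_hom(3))
  next
    case (a_inv h)
    interpret ring_hom_ring R R II
      using hom by (intro ring_hom_ringI2 R.ring_axioms)
    show ?case using a_inv by simp
  next
    case (eng_add h1 h2)
    then show ?case using ring_hom_add[OF hom] by simp
  next
    case (eng_mult h1 h2)
    then show ?case using ring_hom_mult[OF hom] by simp
  }
qed

lemma alg_B_add: "V \<in> \<B> \<Longrightarrow> W \<in> \<B> \<Longrightarrow> V \<oplus>\<^bsub>R\<^esub> W \<in> \<B>"
  and alg_B_mult: "V \<in> \<B> \<Longrightarrow> W \<in> \<B> \<Longrightarrow> V \<otimes>\<^bsub>R\<^esub> W \<in> \<B>"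
  and op_L_in_alg_B: "op_L q a b c d \<in> \<B>"
  and op_Lam_in_alg_B: "op_fun \<Lambda> \<in> \<B>"
  and one_in_alg_B: "\<one>\<^bsub>R\<^esub> \<in> \<B>"
  unfolding alg_B_def generate_algebra_def op_Lam_def
  by (auto intro: generate_ring.intros)

lemma Lam_eval_in_alg_B: "op_fun (rf_eval \<Lambda> p) \<in> \<B>"
proof -
  have "op_fun (rf_eval \<Lambda> p) \<in> alg_K q a b c d"
    by (simp add: alg_K_eq[OF q])
  moreover have "alg_K q a b c d \<subseteq> \<B>"
    unfolding alg_K_def alg_B_def generate_algebra_def
    by (rule R.mono_generate_ring) (auto simp: op_fun_closed op_Lam_def op_L_closed)
  ultimately show ?thesis by blast
qed

lemma fun_mult_apply: "(op_fun h \<otimes>\<^bsub>R\<^esub> V) j = h * V j"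
  by (simp add: op_ring_def op_mult_term_left[OF q] rf_shift_zero[OF q])

lemma mult_fun_apply:
  assumes "V \<in> carrier R"
  shows "(V \<otimes>\<^bsub>R\<^esub> op_fun h) j = V j * rf_shift q j h"
proof -
  have "(V \<otimes>\<^bsub>R\<^esub> op_fun h) j = (\<Sum>i | V i \<noteq> 0. if i = j then V j * rf_shift q j h else 0)"
    unfolding op_ring_def op_mult_def
    by (simp, rule sum.cong) (auto simp: op_term_def shift_hom)
  then show ?thesis
    using assms by (simp add: op_ring_def)
qed

lemma add_apply: "(V \<oplus>\<^bsub>R\<^esub> W) j = V j + W j"
  by (simp add: op_ring_def)

section \<open>The fixed field of the reflection\<close>

lemma Lam_eval_nz: "p \<noteq> 0 \<Longrightarrow> rf_eval \<Lambda> p \<noteq> 0"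
  by (rule rf_eval_nz[OF Lam_nonconst])

lemma rf_subst_Lam_invariant: "\<rho> (rf_subst \<Lambda> f) = rf_subst \<Lambda> f"
  unfolding reflect_def rf_subst_subst[OF reflect_nonconst[OF q abcd]]
  by (fold reflect_def) (simp only: reflect_Lam)

text \<open>\<open>\<complex>(x)\<close> is a quadratic extension of \<open>\<complex>(\<Lambda>)\<close> with \<open>\<rho>\<close> as its conjugation, so that
  denominators can be moved into \<open>\<complex>(\<Lambda>)\<close> by taking norms.\<close>

lemma invariant_is_rf_subst_Lam:
  assumes "\<rho> h = h"
  obtains f where "h = rf_subst \<Lambda> f"
proof -
  \<comment> \<open>\<open>K\<close> is the field of rational functions of \<open>\<Lambda>\<close>.
    The set \<open>M\<close> is shown to be closed under sums, products and quotients; as it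
    contains the constants and x, it is the whole field.\<close>
  define K where "K = range (rf_subst \<Lambda>)"
  define M where "M = {u + v * rf_X | u v. u \<in> K \<and> v \<in> K}"
  define k where "k = a * b * c * d / q"
  have k: "k \<noteq> 0" using q abcd by (simp add: k_def)
  note hom = Lam_nonconst
  have Kc: "rf_const u \<in> K" for u
    unfolding K_def by (metis rangeI rf_subst_const[OF hom])
  have K0: "0 \<in> K" and K1: "1 \<in> K"
    using Kc[of 0] Kc[of 1] by simp_all
  have KL: "\<Lambda> \<in> K"
    unfolding K_def by (metis rangeI rf_subst_X[OF hom])
  have Kadd: "u + v \<in> K" and Kmult: "u * v \<in> K" and Kdiv: "u / v \<in> K" and Kdiff: "u - v \<in> K"
    if "u \<in> K" "v \<in> K" for u v
    using that unfolding K_def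
    by (auto simp flip: rf_subst_add[OF hom] rf_subst_mult[OF hom] rf_subst_divide[OF hom]
        rf_subst_diff[OF hom])
  have Kinv: "\<rho> u = u" if "u \<in> K" for u
    using that by (auto simp: K_def rf_subst_Lam_invariant)
  \<comment> \<open>\<open>t\<close> is the trace of x and 1/k its norm, so x is a root of X^2 - t X
    + 1/k; this reduces products in \<open>M\<close> to degree one in x.\<close>
  define t where "t = (\<Lambda> + rf_const (1 + k)) / rf_const k"
  have t: "t \<in> K"
    unfolding t_def by (intro Kadd Kdiv KL Kc)
  have t_eq: "t = rf_X + \<rho> rf_X"
    using k unfolding t_def reflect_X Lam_eq k_def[symmetric] by (simp add: field_simps)
  have norm: "rf_X * \<rho> rf_X = inverse (rf_const k)"
    using k unfolding reflect_X k_def[symmetric] by (simp add: field_simps)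
  have X_sq: "rf_X * rf_X = t * rf_X - inverse (rf_const k)"
    unfolding t_eq norm[symmetric] by (simp add: algebra_simps)
  have n: "inverse (rf_const k) \<in> K"
    using Kc[of "inverse k"] by (simp add: rf_const_inverse)
  have MI: "u + v * rf_X \<in> M" if "u \<in> K" "v \<in> K" for u v
    using that unfolding M_def by blast
  have KM: "u \<in> M" if "u \<in> K" for u
    using MI[OF that K0] by simp
  have Madd: "f + g \<in> M" if "f \<in> M" "g \<in> M" for f g
  proof -
    from that obtain u v u' v' where "f = u + v * rf_X" "g = u' + v' * rf_X"
      "u \<in> K" "v \<in> K" "u' \<in> K" "v' \<in> K" by (auto simp: M_def)
    moreover from this have "f + g = (u + u') + (v + v') * rf_X"
      by (simp add: algebra_simps)
    ultimately show ?thesis by (simp only: MI Kadd)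
  qed
  have Mmult: "f * g \<in> M" if "f \<in> M" "g \<in> M" for f g
  proof -
    from that obtain u v u' v' where *: "f = u + v * rf_X" "g = u' + v' * rf_X"
      "u \<in> K" "v \<in> K" "u' \<in> K" "v' \<in> K" by (auto simp: M_def)
    have "f * g = u * u' + (u * v' + v * u') * rf_X + v * v' * (rf_X * rf_X)"
      by (simp add: * algebra_simps)
    also have "\<dots> = (u * u' - v * v' * inverse (rf_const k))
        + (u * v' + v * u' + v * v' * t) * rf_X"
      unfolding X_sq by (simp add: algebra_simps)
    finally show ?thesis
      using * n t by (simp only: MI Kadd Kmult Kdiff)
  qed
  have MX: "rf_X \<in> M" using MI[OF K0 K1] by simp
  have poly_M: "rf_eval rf_X p \<in> M" for p
  proof (induction p)
    case 0
    show ?case using K0 KM by simp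
  next
    case (pCons u p)
    then show ?case
      using Kc KM Madd Mmult MX by simp
  qed
  \<comment> \<open>Expand the quotient by the conjugate \<open>\<rho> g\<close>: the denominator
    becomes the norm \<open>g * \<rho> g\<close>, an element of \<open>K\<close>.\<close>
  have div_M: "f / g \<in> M" if f: "f \<in> M" and g: "g \<in> M" "g \<noteq> 0" for f g
  proof -
    from g obtain u v where uv: "g = u + v * rf_X" "u \<in> K" "v \<in> K"
      by (auto simp: M_def)
    then have rg: "\<rho> g = u + v * \<rho> rf_X"
      by (simp only: reflect_hom(4,5) Kinv)
    have "\<rho> g = (u + v * t) + (0 - v) * rf_X"
      unfolding rg t_eq by (simp add: algebra_simps)
    then have rM: "\<rho> g \<in> M"
      using uv K0 t by (simp only: MI Kadd Kmult Kdiff)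
    have "g * \<rho> g = u * u + u * v * t + v * v * (rf_X * \<rho> rf_X)"
      unfolding rg t_eq by (simp add: uv algebra_simps)
    then have "g * \<rho> g \<in> K"
      unfolding norm using uv Kadd Kmult n t by simp
    then have "1 / (g * \<rho> g) \<in> M"
      using Kdiv K1 KM by blast
    then have "f * \<rho> g * (1 / (g * \<rho> g)) \<in> M"
      using Mmult f rM by blast
    moreover have "\<rho> g \<noteq> 0"
      using g reflect_eq_0_iff[OF q abcd] by blast
    ultimately show ?thesis using g(2) by simp
  qed
  have "h \<in> M"
    using div_M[OF poly_M poly_M rf_eval_nz[OF rf_X_nonconst], of "snd (quot_of_fract h)"]
    rf_subst_id[of h] unfolding rf_subst_def by (metis snd_quot_of_fract_nonzero)
  then obtain u v where uv: "h = u + v * rf_X" "u \<in> K" "v \<in> K"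
    by (auto simp: M_def)
  \<comment> \<open>Invariance of \<open>h\<close> forces \<open>v = 0\<close>, because x is not
    fixed: otherwise k x^2 = 1.\<close>
  have "\<rho> h = u + v * \<rho> rf_X"
    unfolding uv(1) reflect_hom(4,5) by (simp only: uv Kinv)
  then have "v * (rf_X - \<rho> rf_X) = 0"
    using assms uv(1) by (auto simp: algebra_simps)
  moreover have "rf_X \<noteq> \<rho> rf_X"
  proof
    assume "rf_X = \<rho> rf_X"
    then have "1 - rf_const k * rf_X ^ 2 = 0"
      using norm k by (simp add: power2_eq_square field_simps)
    then show False using one_minus_X_sq_nz by blast
  qed
  ultimately have "h = u" using uv(1) by simp
  then show ?thesis using that uv(2) K_def by blast
qed

section \<open>Prescribed top coefficients and induction on the order\<close>

lemma invariant_decomposition: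
  assumes "\<rho> w \<noteq> w"
  obtains f g where "\<rho> f = f" "\<rho> g = g" "h = f + g * w"
proof -
  \<comment> \<open>Cramer's rule for h = f + g w together with its reflection. Numerator and
    denominator of \<open>g\<close> both change sign under \<open>\<rho>\<close>, so
    \<open>g\<close> is invariant.\<close>
  define g where "g = (h - \<rho> h) / (w - \<rho> w)"
  note rr = reflect_reflect[OF q abcd]
  have nz: "w - \<rho> w \<noteq> 0" "\<rho> w - w \<noteq> 0" using assms by auto
  have g: "g * (w - \<rho> w) = h - \<rho> h" using nz by (simp add: g_def)
  have r: "\<rho> g = g"
    using nz unfolding g_def reflect_hom(8,9) rr by (simp add: divide_simps) (simp add: algebra_simps)
  have "\<rho> (h - g * w) = h - g * w"
    unfolding reflect_hom(5,8) r using g by (simp add: algebra_simps)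
  then show ?thesis
    using r by (intro that[of "h - g * w" g]) simp_all
qed

text \<open>With s = q^i, the two sides differ, up to a factor 1/(s x) and sign, by (1 - s^2)(1 - k
  x^2). Thus the shift of \<open>\<Lambda>\<close> can serve as \<open>w\<close> in
  \<open>invariant_decomposition\<close>.\<close>

lemma shift_Lam_not_invariant:
  assumes "q powi i * q powi i \<noteq> 1"
  shows "\<rho> (rf_shift q i \<Lambda>) \<noteq> rf_shift q i \<Lambda>"
proof
  define k where "k = a * b * c * d / q"
  define s where "s = q powi i"
  have k: "k \<noteq> 0" and s: "s \<noteq> 0" using q abcd by (simp_all add: k_def s_def)
  have S: "rf_shift q i \<Lambda>
      = inverse (rf_const s * rf_X) + rf_const k * (rf_const s * rf_X) - rf_const (1 + k)"
    unfolding Lam_eq shift_hom k_def s_def by simp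
  assume "\<rho> (rf_shift q i \<Lambda>) = rf_shift q i \<Lambda>"
  then have "rf_const k * rf_X / rf_const s + rf_const s / rf_X
      = inverse (rf_const s * rf_X) + rf_const k * (rf_const s * rf_X)"
    using k s unfolding S reflect_hom(3,4,5,8,10) reflect_X k_def[symmetric]
    by (simp add: field_simps)
  then have "(1 - rf_const (s * s)) * (1 - rf_const k * rf_X ^ 2) = 0"
    using k s by (simp add: rf_const_mult field_simps power2_eq_square)
  then have "rf_const (s * s) = rf_const 1"
    using one_minus_X_sq_nz by simp
  then show False using assms by (simp only: rf_const_eq_iff s_def)
qed

text \<open>Powers of \<open>L\<close> do this: their top coefficients are products of shifts of
  \<open>A_coeff\<close>.\<close>

lemma alg_B_leading_coeff:
  "\<exists>P\<in>\<B>. P (int n) \<noteq> 0 \<and> (\<forall>j > int n. P j = 0)"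
proof (induction n)
  case 0
  show ?case
    using one_in_alg_B by (intro bexI[of _ "\<one>\<^bsub>R\<^esub>"]) (simp_all add: op_ring_def op_term_def)
next
  case (Suc n)
  then obtain P where P: "P \<in> \<B>" "P (int n) \<noteq> 0" "\<And>j. j > int n \<Longrightarrow> P j = 0" by blast
  have "(op_L q a b c d \<otimes>\<^bsub>R\<^esub> P) m
      = (\<Sum>i\<in>{-1, 0, 1}. op_L q a b c d i * rf_shift q i (P (m - i)))" for m
    unfolding op_ring_def by (simp only: monoid.simps, rule op_mult_eq[OF q]) (auto simp: op_L_def)
  \<comment> \<open>For \<open>m > int n\<close> the indices \<open>m\<close> and
    \<open>m + 1\<close> lie above the support of \<open>P\<close>, so only \<open>i = 1\<close>
    contributes.\<close>
  then have "(op_L q a b c d \<otimes>\<^bsub>R\<^esub> P) m = A_coeff q a b c d * rf_shift q 1 (P (m - 1))"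
    if "m > int n" for m
    using that by (simp add: P(3) shift_hom(1) op_L_def)
  then show ?case
    using P alg_B_mult[OF op_L_in_alg_B P(1)] A_coeff_nz
      rf_subst_eq_0_iff[OF shift_nonconst[OF q], folded rf_shift_def]
    by (intro bexI[of _ "op_L q a b c d \<otimes>\<^bsub>R\<^esub> P"]) (simp_all add: shift_hom(1))
qed

text \<open>The order reduction shared by left and right fractions. It suffices to bound the
  positive powers of E, since invariance ties the coefficient at -j to the one at j.\<close>

lemma invariant_induct:
  assumes add: "\<And>V W. V \<in> S \<Longrightarrow> W \<in> S \<Longrightarrow> V \<oplus>\<^bsub>R\<^esub> W \<in> S"
    and "fun": "\<And>h. \<rho> h = h \<Longrightarrow> op_fun h \<in> S"
    and top: "\<And>n h. n > 0 \<Longrightarrow> \<exists>V\<in>S. II V = V \<and> V (int n) = h \<and> (\<forall>j > int n. V j = 0)"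
    and T: "T \<in> carrier R" "II T = T"
  shows "T \<in> S"
proof -
  have "T \<in> S" if "II T = T" "\<forall>j > int n. T j = 0" for n T
    using that
  proof (induction n arbitrary: T)
    case 0
    have inv: "T j = \<rho> (T (- j))" for j
      using 0(1) by (metis op_I_def)
    have "T j = op_fun (T 0) j" for j
      using 0(2) inv[of j] by (cases "j < 0"; cases "j = 0") (auto simp: op_term_def reflect_hom(1))
    then have "T = op_fun (T 0)" by blast
    moreover have "op_fun (T 0) \<in> S"
      using "fun" inv[of 0] by simp
    ultimately show ?case by simp
  next
    case (Suc n)
    obtain V where V: "V \<in> S" "II V = V" "V (int (Suc n)) = T (int (Suc n))"
      "\<forall>j > int (Suc n). V j = 0"
      using top by blast
    \<comment> \<open>The difference is again invariant, and its coefficient at \<open>Suc n\<close>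
      has been cancelled.\<close>
    let ?D = "\<lambda>j. T j - V j"
    have "II ?D = ?D"
    proof
      show "II ?D j = ?D j" for j
        using fun_cong[OF Suc.prems(1), of j] fun_cong[OF V(2), of j]
        by (simp add: op_I_def reflect_hom(8))
    qed
    moreover have "\<forall>j > int n. ?D j = 0"
    proof (intro allI impI)
      fix j :: int assume "j > int n"
      then consider "j = int (Suc n)" | "j > int (Suc n)" by linarith
      then show "?D j = 0" using V Suc.prems(2) by cases auto
    qed
    ultimately have "?D \<oplus>\<^bsub>R\<^esub> V \<in> S"
      using Suc.IH add V(1) by blast
    then show ?case by (simp add: op_ring_def)
  qed
  moreover obtain n where "\<forall>j > int n. T j = 0"
  proof -
    have "finite {j. T j \<noteq> 0}" using T(1) by (simp add: op_ring_def)
    then obtain m where m: "\<And>j. T j \<noteq> 0 \<Longrightarrow> j \<le> m"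
      using bdd_above_finite[of "{j. T j \<noteq> 0}"] unfolding bdd_above_def by blast
    \<comment> \<open>\<open>nat\<close> covers the case that the upper bound \<open>m\<close> of
      the support is negative.\<close>
    have "T j = 0" if "j > int (nat m)" for j
      using m[of j] that by linarith
    then have "\<forall>j > int (nat m). T j = 0" by blast
    then show ?thesis by (rule that)
  qed
  ultimately show ?thesis using T(2) by blast
qed

section \<open>Left and right fractions over \<open>\<B>\<close>\<close>

lemma op_I_mult_fixed: "II V = V \<Longrightarrow> II W = W \<Longrightarrow> II (V \<otimes>\<^bsub>R\<^esub> W) = V \<otimes>\<^bsub>R\<^esub> W"
  by (simp add: op_ring_def op_I_mult[OF q abcd])

lemma op_I_fun_fixed: "\<rho> h = h \<Longrightarrow> II (op_fun h) = op_fun h"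
  by (simp add: op_I_fun[OF q abcd])

lemma op_I_alg_B: "V \<in> \<B> \<Longrightarrow> II V = V"
  using alg_B_closed_invariant by blast

lemma Lam_eval_invariant: "\<rho> (rf_eval \<Lambda> p) = rf_eval \<Lambda> p"
  unfolding reflect_def rf_subst_eval[OF reflect_nonconst[OF q abcd]]
  by (fold reflect_def) (simp only: reflect_Lam)

lemma inverse_Lam_eval_invariant: "\<rho> (inverse (rf_eval \<Lambda> p)) = inverse (rf_eval \<Lambda> p)"
  by (simp only: reflect_hom(10) Lam_eval_invariant)

lemma invariant_fraction:
  assumes "\<rho> h = h"
  obtains p p' where "p' \<noteq> 0" "h = inverse (rf_eval \<Lambda> p') * rf_eval \<Lambda> p"
proof -
  obtain f where "h = rf_subst \<Lambda> f"
    using assms by (rule invariant_is_rf_subst_Lam)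
  then have "h = inverse (rf_eval \<Lambda> (snd (quot_of_fract f))) * rf_eval \<Lambda> (fst (quot_of_fract f))"
    by (simp add: rf_subst_def divide_inverse mult.commute)
  then show ?thesis by (rule that[rotated]) simp
qed

text \<open>Denominators are recorded by nonzero polynomials in \<open>\<Lambda>\<close>, so that a
  common denominator is simply a product of polynomials.\<close>

definition left_fractions where
  "left_fractions = {op_fun (inverse (rf_eval \<Lambda> p)) \<otimes>\<^bsub>R\<^esub> V | p V. p \<noteq> 0 \<and> V \<in> \<B>}"

definition right_fractions where
  "right_fractions = {V \<otimes>\<^bsub>R\<^esub> op_fun (inverse (rf_eval \<Lambda> p)) | p V. p \<noteq> 0 \<and> V \<in> \<B>}"

text \<open>\<open>\<Lambda>\<close> is transcendental over the constants, so nonzero elements of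
  \<open>alg_K\<close> correspond to nonzero \<open>p\<close>. The predicate \<open>Q\<close> lets
  one statement serve both sides.\<close>

lemma bex_alg_K_nonzero:
  "(\<exists>\<Theta> \<in> alg_K q a b c d. \<Theta> \<noteq> \<zero>\<^bsub>R\<^esub> \<and> Q (inv\<^bsub>R\<^esub> \<Theta>))
     \<longleftrightarrow> (\<exists>p. p \<noteq> 0 \<and> Q (op_fun (inverse (rf_eval \<Lambda> p))))"
proof -
  have "op_fun h = \<zero>\<^bsub>R\<^esub> \<longleftrightarrow> h = 0" for h
    by (auto simp: op_ring_def op_term_def fun_eq_iff)
  moreover have "rf_eval \<Lambda> p = 0 \<longleftrightarrow> p = 0" for p
    using Lam_eval_nz by auto
  ultimately show ?thesis
    unfolding alg_K_eq[OF q] by (auto simp: inv_op_fun[OF q])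
qed

lemma left_fractions_eq:
  "T \<in> left_fractions \<longleftrightarrow> (\<exists>V \<in> \<B>. \<exists>\<Theta> \<in> alg_K q a b c d.
     \<Theta> \<noteq> \<zero>\<^bsub>R\<^esub> \<and> T = inv\<^bsub>R\<^esub> \<Theta> \<otimes>\<^bsub>R\<^esub> V)"
  unfolding left_fractions_def bex_alg_K_nonzero[of "\<lambda>X. T = X \<otimes>\<^bsub>R\<^esub> V" for V]
  by blast

lemma right_fractions_eq:
  "T \<in> right_fractions \<longleftrightarrow> (\<exists>U \<in> \<B>. \<exists>\<Gamma> \<in> alg_K q a b c d.
     \<Gamma> \<noteq> \<zero>\<^bsub>R\<^esub> \<and> T = U \<otimes>\<^bsub>R\<^esub> inv\<^bsub>R\<^esub> \<Gamma>)"
  unfolding right_fractions_def bex_alg_K_nonzero[of "\<lambda>X. T = U \<otimes>\<^bsub>R\<^esub> X" for U]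
  by blast

lemma left_fractions_add:
  assumes "S \<in> left_fractions" "T \<in> left_fractions"
  shows "S \<oplus>\<^bsub>R\<^esub> T \<in> left_fractions"
proof -
  from assms obtain p V p' V' where *: "p \<noteq> 0" "V \<in> \<B>" "p' \<noteq> 0" "V' \<in> \<B>"
    "S = op_fun (inverse (rf_eval \<Lambda> p)) \<otimes>\<^bsub>R\<^esub> V" "T = op_fun (inverse (rf_eval \<Lambda> p')) \<otimes>\<^bsub>R\<^esub> V'"
    unfolding left_fractions_def by blast
  let ?W = "(op_fun (rf_eval \<Lambda> p') \<otimes>\<^bsub>R\<^esub> V) \<oplus>\<^bsub>R\<^esub> (op_fun (rf_eval \<Lambda> p) \<otimes>\<^bsub>R\<^esub> V')"
  have "S \<oplus>\<^bsub>R\<^esub> T = op_fun (inverse (rf_eval \<Lambda> (p * p'))) \<otimes>\<^bsub>R\<^esub> ?W"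
    using Lam_eval_nz[OF *(1)] Lam_eval_nz[OF *(3)]
    by (simp add: fun_eq_iff *(5,6) fun_mult_apply add_apply rf_eval_mult field_simps)
  moreover have "?W \<in> \<B>"
    using * by (intro alg_B_add alg_B_mult Lam_eval_in_alg_B)
  ultimately show ?thesis
    using * unfolding left_fractions_def by (auto intro!: exI[of _ "p * p'"])
qed

lemma right_fractions_add:
  assumes "S \<in> right_fractions" "T \<in> right_fractions"
  shows "S \<oplus>\<^bsub>R\<^esub> T \<in> right_fractions"
proof -
  from assms obtain p V p' V' where *: "p \<noteq> 0" "V \<in> \<B>" "p' \<noteq> 0" "V' \<in> \<B>"
    "S = V \<otimes>\<^bsub>R\<^esub> op_fun (inverse (rf_eval \<Lambda> p))" "T = V' \<otimes>\<^bsub>R\<^esub> op_fun (inverse (rf_eval \<Lambda> p'))"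
    unfolding right_fractions_def by blast
  let ?W = "(V \<otimes>\<^bsub>R\<^esub> op_fun (rf_eval \<Lambda> p')) \<oplus>\<^bsub>R\<^esub> (V' \<otimes>\<^bsub>R\<^esub> op_fun (rf_eval \<Lambda> p))"
  have W: "?W \<in> \<B>"
    using * by (intro alg_B_add alg_B_mult Lam_eval_in_alg_B)
  \<comment> \<open>A function on the right reaches the coefficient at j shifted by q^j, so every
    shift of the denominators has to be nonzero.\<close>
  have nz: "rf_shift q j (rf_eval \<Lambda> p) \<noteq> 0" "rf_shift q j (rf_eval \<Lambda> p') \<noteq> 0" for j
    using Lam_eval_nz[OF *(1)] Lam_eval_nz[OF *(3)]
      rf_subst_eq_0_iff[OF shift_nonconst[OF q], folded rf_shift_def] by simp_all
  have "V \<in> carrier R" "V' \<in> carrier R" "?W \<in> carrier R"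
    using *(2,4) W alg_B_closed_invariant by blast+
  then have "S \<oplus>\<^bsub>R\<^esub> T = ?W \<otimes>\<^bsub>R\<^esub> op_fun (inverse (rf_eval \<Lambda> (p * p')))"
    using nz by (simp add: fun_eq_iff *(5,6) mult_fun_apply add_apply rf_eval_mult
        shift_hom(5,9,2) field_simps)
  then show ?thesis
    using * W unfolding right_fractions_def by (auto intro!: exI[of _ "p * p'"])
qed

text \<open>An invariant \<open>h\<close> is a quotient of polynomials in \<open>\<Lambda>\<close>;
  its numerator is absorbed into \<open>\<B>\<close>.\<close>

lemma left_fractions_fun_mult:
  assumes "\<rho> h = h" "W \<in> \<B>"
  shows "op_fun h \<otimes>\<^bsub>R\<^esub> W \<in> left_fractions"
proof -
  obtain p p' where *: "p' \<noteq> 0" "h = inverse (rf_eval \<Lambda> p') * rf_eval \<Lambda> p"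
    using assms(1) by (rule invariant_fraction)
  then have "op_fun h \<otimes>\<^bsub>R\<^esub> W
      = op_fun (inverse (rf_eval \<Lambda> p')) \<otimes>\<^bsub>R\<^esub> (op_fun (rf_eval \<Lambda> p) \<otimes>\<^bsub>R\<^esub> W)"
    by (simp add: fun_eq_iff fun_mult_apply mult.assoc)
  then show ?thesis
    using * alg_B_mult[OF Lam_eval_in_alg_B assms(2)] unfolding left_fractions_def by blast
qed

lemma right_fractions_mult_fun:
  assumes "\<rho> h = h" "W \<in> \<B>"
  shows "W \<otimes>\<^bsub>R\<^esub> op_fun h \<in> right_fractions"
proof -
  obtain p p' where *: "p' \<noteq> 0" "h = inverse (rf_eval \<Lambda> p') * rf_eval \<Lambda> p"
    using assms(1) by (rule invariant_fraction)
  have "W \<in> carrier R"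
    using assms(2) alg_B_closed_invariant by blast
  then have "W \<otimes>\<^bsub>R\<^esub> op_fun h
      = (W \<otimes>\<^bsub>R\<^esub> op_fun (rf_eval \<Lambda> p)) \<otimes>\<^bsub>R\<^esub> op_fun (inverse (rf_eval \<Lambda> p'))"
    by (simp add: *(2) R.m_assoc op_fun_closed op_fun_mult[OF q] mult.commute)
  then show ?thesis
    using * alg_B_mult[OF assms(2) Lam_eval_in_alg_B] unfolding right_fractions_def by blast
qed

lemma left_fractions_invariant:
  assumes "T \<in> left_fractions"
  shows "II T = T"
proof -
  from assms obtain p V where "T = op_fun (inverse (rf_eval \<Lambda> p)) \<otimes>\<^bsub>R\<^esub> V" "V \<in> \<B>"
    unfolding left_fractions_def by blast
  then show ?thesis
    by (simp only: op_I_mult_fixed op_I_fun_fixed inverse_Lam_eval_invariant op_I_alg_B)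
qed

lemma right_fractions_invariant:
  assumes "T \<in> right_fractions"
  shows "II T = T"
proof -
  from assms obtain p V where "T = V \<otimes>\<^bsub>R\<^esub> op_fun (inverse (rf_eval \<Lambda> p))" "V \<in> \<B>"
    unfolding right_fractions_def by blast
  then show ?thesis
    by (simp only: op_I_mult_fixed op_I_fun_fixed inverse_Lam_eval_invariant op_I_alg_B)
qed

section \<open>Invariant operators are fractions\<close>

context
  assumes not_root_of_unity: "\<And>i :: int. i \<noteq> 0 \<Longrightarrow> q powi i * q powi i \<noteq> 1"
begin

lemma invariant_in_left_fractions:
  assumes "T \<in> carrier R" "II T = T"
  shows "T \<in> left_fractions"
proof (rule invariant_induct[OF left_fractions_add _ _ assms])
  show "op_fun h \<in> left_fractions" if "\<rho> h = h" for h
    using left_fractions_fun_mult[OF that one_in_alg_B] by (simp add: op_fun_closed)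
next
  fix n :: nat and h :: ratfun
  assume n: "n > 0"
  obtain P where P: "P \<in> \<B>" "P (int n) \<noteq> 0" "\<forall>j > int n. P j = 0"
    using alg_B_leading_coeff by blast
  \<comment> \<open>In \<open>P \<Lambda>\<close> the coefficient at E^n is \<open>P (int n)\<close>
    times the shift of \<open>\<Lambda>\<close>, so this equation prescribes the top coefficient
    \<open>h\<close> of \<open>?V\<close>.\<close>
  obtain f g where fg: "\<rho> f = f" "\<rho> g = g" "h / P (int n) = f + g * rf_shift q (int n) \<Lambda>"
    using invariant_decomposition shift_Lam_not_invariant not_root_of_unity n by (metis of_nat_0_less_iff less_irrefl)
  let ?V = "(op_fun f \<otimes>\<^bsub>R\<^esub> P) \<oplus>\<^bsub>R\<^esub> (op_fun g \<otimes>\<^bsub>R\<^esub> (P \<otimes>\<^bsub>R\<^esub> op_fun \<Lambda>))"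
  have apply_V: "?V j = P j * (f + g * rf_shift q j \<Lambda>)" for j
    using alg_B_closed_invariant[OF P(1)]
    by (simp add: add_apply fun_mult_apply mult_fun_apply algebra_simps)
  have V: "?V \<in> left_fractions"
    using fg P by (intro left_fractions_add left_fractions_fun_mult alg_B_mult op_Lam_in_alg_B)
  moreover have "?V (int n) = h"
    unfolding apply_V fg(3)[symmetric] using P(2) by simp
  moreover have "\<forall>j > int n. ?V j = 0"
    unfolding apply_V using P(3) by simp
  ultimately show "\<exists>V\<in>left_fractions. II V = V \<and> V (int n) = h \<and> (\<forall>j > int n. V j = 0)"
    using left_fractions_invariant by blast
qed

lemma invariant_in_right_fractions:
  assumes "T \<in> carrier R" "II T = T"
  shows "T \<in> right_fractions"
proof (rule invariant_induct[OF right_fractions_add _ _ assms])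
  show "op_fun h \<in> right_fractions" if "\<rho> h = h" for h
    using right_fractions_mult_fun[OF that one_in_alg_B] by (simp add: op_fun_closed)
next
  fix n :: nat and h :: ratfun
  assume n: "n > 0"
  obtain P where P: "P \<in> \<B>" "P (int n) \<noteq> 0" "\<forall>j > int n. P j = 0"
    using alg_B_leading_coeff by blast
  \<comment> \<open>Here \<open>f\<close> and \<open>g\<close> stand on the right and reach the
    coefficient at E^n shifted by q^n. Shifting the desired equation back by -n leaves them
    unshifted and moves the shift onto \<open>\<Lambda>\<close>.\<close>
  obtain f g where fg: "\<rho> f = f" "\<rho> g = g"
    "rf_shift q (- int n) (h / P (int n)) = f + g * rf_shift q (- int n) \<Lambda>"
    using invariant_decomposition shift_Lam_not_invariant not_root_of_unity n
    by (metis neg_equal_0_iff_equal of_nat_0_less_iff less_irrefl)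
  let ?V = "(P \<otimes>\<^bsub>R\<^esub> op_fun f) \<oplus>\<^bsub>R\<^esub> ((op_fun \<Lambda> \<otimes>\<^bsub>R\<^esub> P) \<otimes>\<^bsub>R\<^esub> op_fun g)"
  have apply_V: "?V j = P j * (rf_shift q j f + rf_shift q j g * \<Lambda>)" for j
    using alg_B_closed_invariant[OF P(1)]
    by (simp add: add_apply fun_mult_apply mult_fun_apply op_fun_closed algebra_simps)
  have V: "?V \<in> right_fractions"
    using fg P by (intro right_fractions_add right_fractions_mult_fun alg_B_mult op_Lam_in_alg_B)
  moreover have "?V (int n) = h"
  proof -
    have "h / P (int n) = rf_shift q (int n) (rf_shift q (- int n) (h / P (int n)))"
      by (simp add: rf_shift_shift[OF q] rf_shift_zero[OF q])
    also have "\<dots> = rf_shift q (int n) f + rf_shift q (int n) g * \<Lambda>"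
      unfolding fg(3) shift_hom(4,5) by (simp add: rf_shift_shift[OF q] rf_shift_zero[OF q])
    finally show ?thesis
      using P(2) unfolding apply_V by (simp add: field_simps)
  qed
  moreover have "\<forall>j > int n. ?V j = 0"
    unfolding apply_V using P(3) by simp
  ultimately show "\<exists>V\<in>right_fractions. II V = V \<and> V (int n) = h \<and> (\<forall>j > int n. V j = 0)"
    using right_fractions_invariant by blast
qed

end

end

theorem theorem3p3:
  fixes q :: real and a b c d :: complex and T :: diffop
  assumes "0 < q" and "q < 1"
    and "a \<noteq> 0" and "b \<noteq> 0" and "c \<noteq> 0" and "d \<noteq> 0"
    and "T \<in> carrier (op_ring q)"
  shows
    "(op_I q a b c d T = T \<longleftrightarrow>
        (\<exists>V \<in> alg_B q a b c d. \<exists>\<Theta> \<in> alg_K q a b c d.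
           \<Theta> \<noteq> \<zero>\<^bsub>op_ring q\<^esub> \<and> T = inv\<^bsub>op_ring q\<^esub> \<Theta> \<otimes>\<^bsub>op_ring q\<^esub> V)) \<and>
     (op_I q a b c d T = T \<longleftrightarrow>
        (\<exists>U \<in> alg_B q a b c d. \<exists>\<Gamma> \<in> alg_K q a b c d.
           \<Gamma> \<noteq> \<zero>\<^bsub>op_ring q\<^esub> \<and> T = U \<otimes>\<^bsub>op_ring q\<^esub> inv\<^bsub>op_ring q\<^esub> \<Gamma>))"
proof -
  have q: "complex_of_real q \<noteq> 0" using assms(1) by simp
  have root: "complex_of_real q powi i * complex_of_real q powi i \<noteq> 1" if "i \<noteq> 0" for i :: int
  proof
    assume "complex_of_real q powi i * complex_of_real q powi i = 1"
    then have "complex_of_real (q powi i * q powi i) = 1"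
      by (simp only: of_real_mult of_real_power_int)
    then have "q powi i * q powi i = 1"
      by (simp only: of_real_eq_1_iff)
    then have "q powi (i + i) = 1"
      using assms(1) power_int_add[of q i i] by simp
    \<comment> \<open>As a real power this is exp(2 i ln q), and ln q is nonzero for 0 < q <
      1.\<close>
    then have "q powr real_of_int (i + i) = 1"
      using assms(1) powr_real_of_int'[of q "i + i"] by simp
    then show False
      using assms(1,2) that by (simp add: powr_def)
  qed
  note ctx = q assms(3-6)
  show ?thesis
    unfolding left_fractions_eq[OF ctx, symmetric] right_fractions_eq[OF ctx, symmetric]
    using left_fractions_invariant[OF ctx] right_fractions_invariant[OF ctx]
      invariant_in_left_fractions[OF ctx root assms(7)]
      invariant_in_right_fractions[OF ctx root assms(7)] by blast
qed

end
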